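(* Let $\Delta$ be a simplicial complex of dimension $d\ge 1$. (i) If $\Delta$ is pure and very-weakly-chordal, then it is weakly-ridge-chordal. (ii) If $\Delta$ is pure and mid-chordal, then $\Delta$ is weakly-vertex-chordal. (iii) Mid-chordality and ridge-chordality are independent properties, even for pure complexes: there is a pure complex that is mid-chordal but not ridge-chordal, and a pure complex that is ridge-chordal but not mid-chordal. (In particular, pure mid-chordal complexes are not vertex-chordal in general.) The converses of (i) and (ii) are false: there is a pure weakly-ridge-chordal complex that is not very-weakly-chordal, and a pure weakly-vertex-chordal complex that is not mid-chordal.
   Context: Simplicial complexes are finite. A vertex labeling of a complex with $n$ vertices is a bijection of its vertices with $[n]$; $\max F$ is the largest label in $F$; the size of a face is its number of vertices. Two faces of the same dimension $k$ are adjacent if their intersection has dimension $k-1$. $\Delta$ is: - mid-chordal, if it has a labeling such that for every two facets $F\neq G$ with the same size and same maximum, $\Delta$ contains every $2$-element subset $e$ of $(F\cup G)\setminus\{\max F\}$ and, for each such $e$, some face $H_e$ with $|H_e|=|F|$ and $e\subseteq H_e\subseteq (F\cup G)\setminus\{\max F\}$; - very-weakly-chordal, if it has a labeling such that for every two adjacent facets $F\ne G$ with the same size and same maximum, $(F\cup G)\setminus\{\max F\}$ is a face of $\Delta$. A $t$-clique of a complex $\Gamma$ is a set $X$ of vertices such that any $k+1\le t+1$ vertices of $X$ span a $k$-face of $\Gamma$. A face of $\Gamma$ is $t$-simplicial if the vertices of its star in $\Gamma$ form a $t$-clique of $\Gamma$. Deleting above a face $F$ of $\Gamma$ means passing to the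 complex $\operatorname{abdel}(F,\Gamma)$ whose facets are the facets of $\Gamma$ not containing $F$. The empty set has dimension $-1$. For $0\le j<d$, a $d$-dimensional complex $\Delta$ is $j$-face-chordal (resp. weakly-$j$-face-chordal) if it can be reduced to a complex of dimension $\le j$ by repeatedly deleting above a $j$-face that is $d$-simplicial (resp. $1$-simplicial) in the current complex (here $d$ is always the dimension of the original $\Delta$). (Weakly-)vertex-chordal means (weakly-)$0$-face-chordal, and (weakly-)ridge-chordal means (weakly-)$(d-1)$-face-chordal. *)

theory Defs
  imports Main
begin

text \<open>A complex is the set of all its faces. The void complex (no face at all) is admitted, since
  deleting above a face can remove every facet.\<close>

definition abstract_complex :: "'a set set \<Rightarrow> bool" where
  "abstract_complex \<Delta> \<longleftrightarrow>
     finite \<Delta> \<and> (\<forall>F\<in>\<Delta>. finite F) \<and> (\<forall>F\<in>\<Delta>. \<forall>G. G \<subseteq> F \<longrightarrow> G \<in> \<Delta>)"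

definition complex_vertices :: "'a set set \<Rightarrow> 'a set" where
  "complex_vertices \<Delta> = \<Union>\<Delta>"

definition face_dim :: "'a set \<Rightarrow> int" where
  "face_dim F = int (card F) - 1"

text \<open>The void complex gets dimension \<open>-1\<close>, like the complex whose only face is the empty set.\<close>

definition complex_dim :: "'a set set \<Rightarrow> int" where
  "complex_dim \<Delta> = Max (insert (- 1) (face_dim ` \<Delta>))"

definition is_facet :: "'a set set \<Rightarrow> 'a set \<Rightarrow> bool" where
  "is_facet \<Delta> F \<longleftrightarrow> F \<in> \<Delta> \<and> (\<forall>G\<in>\<Delta>. F \<subseteq> G \<longrightarrow> G = F)"

definition pure_complex :: "'a set set \<Rightarrow> bool" where
  "pure_complex \<Delta> \<longleftrightarrow> (\<forall>F. is_facet \<Delta> F \<longrightarrow> face_dim F = complex_dim \<Delta>)"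

definition adjacent_faces :: "'a set \<Rightarrow> 'a set \<Rightarrow> bool" where
  "adjacent_faces F G \<longleftrightarrow> face_dim F = face_dim G \<and> face_dim (F \<inter> G) = face_dim F - 1"

definition vertex_labeling :: "'a set set \<Rightarrow> ('a \<Rightarrow> nat) \<Rightarrow> bool" where
  "vertex_labeling \<Delta> l \<longleftrightarrow>
     bij_betw l (complex_vertices \<Delta>) {1..card (complex_vertices \<Delta>)}"

definition max_label :: "('a \<Rightarrow> nat) \<Rightarrow> 'a set \<Rightarrow> nat" where
  "max_label l F = Max (l ` F)"

text \<open>The set \<open>(F \<union> G) - {max F}\<close>, where \<open>max F\<close> stands for the vertex carrying the
  largest label of \<open>F\<close>.\<close>

definition union_minus_max :: "('a \<Rightarrow> nat) \<Rightarrow> 'a set \<Rightarrow> 'a set \<Rightarrow> 'a set" where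
  "union_minus_max l F G = {v \<in> F \<union> G. l v \<noteq> max_label l F}"

definition mid_chordal :: "'a set set \<Rightarrow> bool" where
  "mid_chordal \<Delta> \<longleftrightarrow> (\<exists>l. vertex_labeling \<Delta> l \<and>
     (\<forall>F G. is_facet \<Delta> F \<and> is_facet \<Delta> G \<and> F \<noteq> G \<and> card F = card G \<and>
            max_label l F = max_label l G \<longrightarrow>
        (\<forall>e. e \<subseteq> union_minus_max l F G \<and> card e = 2 \<longrightarrow>
           e \<in> \<Delta> \<and>
           (\<exists>H\<in>\<Delta>. card H = card F \<and> e \<subseteq> H \<and> H \<subseteq> union_minus_max l F G))))"

definition very_weakly_chordal :: "'a set set \<Rightarrow> bool" where
  "very_weakly_chordal \<Delta> \<longleftrightarrow> (\<exists>l. vertex_labeling \<Delta> l \<and>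
     (\<forall>F G. is_facet \<Delta> F \<and> is_facet \<Delta> G \<and> F \<noteq> G \<and> adjacent_faces F G \<and>
            card F = card G \<and> max_label l F = max_label l G \<longrightarrow>
        union_minus_max l F G \<in> \<Delta>))"

definition t_clique :: "int \<Rightarrow> 'a set set \<Rightarrow> 'a set \<Rightarrow> bool" where
  "t_clique t \<Gamma> X \<longleftrightarrow>
     X \<subseteq> complex_vertices \<Gamma> \<and> (\<forall>Y. Y \<subseteq> X \<and> face_dim Y \<le> t \<longrightarrow> Y \<in> \<Gamma>)"

definition face_star :: "'a set \<Rightarrow> 'a set set \<Rightarrow> 'a set set" where
  "face_star F \<Gamma> = {G \<in> \<Gamma>. F \<union> G \<in> \<Gamma>}"

definition t_simplicial :: "int \<Rightarrow> 'a set set \<Rightarrow> 'a set \<Rightarrow> bool" where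
  "t_simplicial t \<Gamma> F \<longleftrightarrow> F \<in> \<Gamma> \<and> t_clique t \<Gamma> (complex_vertices (face_star F \<Gamma>))"

definition abdel :: "'a set \<Rightarrow> 'a set set \<Rightarrow> 'a set set" where
  "abdel F \<Gamma> = {H. \<exists>G. is_facet \<Gamma> G \<and> \<not> F \<subseteq> G \<and> H \<subseteq> G}"

definition deletion_step :: "int \<Rightarrow> int \<Rightarrow> 'a set set \<Rightarrow> 'a set set \<Rightarrow> bool" where
  "deletion_step t j \<Gamma> \<Gamma>' \<longleftrightarrow>
     (\<exists>F. face_dim F = j \<and> t_simplicial t \<Gamma> F \<and> \<Gamma>' = abdel F \<Gamma>)"

definition reducible_by :: "int \<Rightarrow> int \<Rightarrow> 'a set set \<Rightarrow> bool" where
  "reducible_by t j \<Delta> \<longleftrightarrow> (\<exists>\<Gamma>. (deletion_step t j)\<^sup>*\<^sup>* \<Delta> \<Gamma> \<and> complex_dim \<Gamma> \<le> j)"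

definition face_chordal :: "int \<Rightarrow> 'a set set \<Rightarrow> bool" where
  "face_chordal j \<Delta> \<longleftrightarrow> 0 \<le> j \<and> j < complex_dim \<Delta> \<and> reducible_by (complex_dim \<Delta>) j \<Delta>"

definition weakly_face_chordal :: "int \<Rightarrow> 'a set set \<Rightarrow> bool" where
  "weakly_face_chordal j \<Delta> \<longleftrightarrow> 0 \<le> j \<and> j < complex_dim \<Delta> \<and> reducible_by 1 j \<Delta>"

definition vertex_chordal :: "'a set set \<Rightarrow> bool" where
  "vertex_chordal \<Delta> \<longleftrightarrow> face_chordal 0 \<Delta>"

definition weakly_vertex_chordal :: "'a set set \<Rightarrow> bool" where
  "weakly_vertex_chordal \<Delta> \<longleftrightarrow> weakly_face_chordal 0 \<Delta>"

definition ridge_chordal :: "'a set set \<Rightarrow> bool" where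
  "ridge_chordal \<Delta> \<longleftrightarrow> face_chordal (complex_dim \<Delta> - 1) \<Delta>"

definition weakly_ridge_chordal :: "'a set set \<Rightarrow> bool" where
  "weakly_ridge_chordal \<Delta> \<longleftrightarrow> weakly_face_chordal (complex_dim \<Delta> - 1) \<Delta>"

end

theory Submission
  imports Defs
begin

text \<open>
  For (i) and (ii), look at the vertex \<open>n\<close> with the largest label among the remaining facets. The
  chordality condition on two facets through \<open>n\<close> only provides faces avoiding \<open>n\<close>, so it makes
  every ridge through \<open>n\<close> (respectively \<open>n\<close> itself) 1-simplicial, and it survives when facets
  through \<open>n\<close> are deleted.

  One complex separates all the other notions from mid-chordality: the five-vertex Moebius band with
  facets \<open>{i, i+1, i+2}\<close> modulo 5. It is reduced through its free boundary edges, and its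
  1-skeleton is complete, but no vertex can carry the largest label. Conversely, add to the boundary
  of a tetrahedron the cones over two of its 4-cycles that together use all six edges: this is
  mid-chordal, since every triple of base vertices is a face, but it has no 2-simplicial vertex or
  edge at all.
\<close>

section \<open>Pure complexes as families of facets of equal size\<close>

text \<open>Pure complexes are handled through their families of facets, so that a reduction becomes
  a chain of subfamilies. The empty family yields the void complex, whereas \<open>{{}}\<close>
  would yield the complex with the empty face only.\<close>

definition generated_complex :: "'a set set \<Rightarrow> 'a set set" where
  "generated_complex S = {H. \<exists>G\<in>S. H \<subseteq> G}"

definition uniform_family :: "nat \<Rightarrow> 'a set set \<Rightarrow> bool" where
  "uniform_family k S \<longleftrightarrow> finite S \<and> (\<forall>F\<in>S. finite F \<and> card F = k)"

lemma generated_complex_iff: "H \<in> generated_complex S \<longleftrightarrow> (\<exists>G\<in>S. H \<subseteq> G)"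
  by (simp add: generated_complex_def)

lemma generated_complex_mono: "H \<in> generated_complex S \<Longrightarrow> K \<subseteq> H \<Longrightarrow> K \<in> generated_complex S"
  unfolding generated_complex_def by blast

lemma uniform_family_subset: "uniform_family k S \<Longrightarrow> T \<subseteq> S \<Longrightarrow> uniform_family k T"
  unfolding uniform_family_def by (meson finite_subset subsetD)

lemma uniform_family_subset_eq:
  "uniform_family k S \<Longrightarrow> F \<in> S \<Longrightarrow> G \<in> S \<Longrightarrow> F \<subseteq> G \<Longrightarrow> F = G"
  unfolding uniform_family_def by (metis card_subset_eq)

lemma finite_generated_complex:
  assumes "uniform_family k S" shows "finite (generated_complex S)"
proof -
  have "generated_complex S = (\<Union>G\<in>S. Pow G)"
    unfolding generated_complex_def by blast
  with assms show ?thesis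
    unfolding uniform_family_def by simp
qed

lemma abstract_complex_generated:
  assumes "uniform_family k S" shows "abstract_complex (generated_complex S)"
  unfolding abstract_complex_def
proof (intro conjI ballI allI impI finite_generated_complex[OF assms])
  show "finite F" if "F \<in> generated_complex S" for F
    using that assms by (auto simp: generated_complex_iff uniform_family_def intro: finite_subset)
qed (rule generated_complex_mono)

lemma complex_vertices_generated: "complex_vertices (generated_complex S) = \<Union>S"
  unfolding complex_vertices_def generated_complex_def by blast

lemma finite_Union_uniform: "uniform_family k S \<Longrightarrow> finite (\<Union>S)"
  unfolding uniform_family_def by blast

text \<open>Sets of equal finite cardinality form an antichain, so no generator is absorbed by
  another one.\<close>

lemma is_facet_generated:
  assumes "uniform_family k S" shows "is_facet (generated_complex S) F \<longleftrightarrow> F \<in> S"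
proof
  assume facet: "is_facet (generated_complex S) F"
  then obtain G where "G \<in> S" "F \<subseteq> G"
    by (auto simp: is_facet_def generated_complex_iff)
  moreover from this have "G = F"
    using facet by (auto simp: is_facet_def generated_complex_iff)
  ultimately show "F \<in> S" by simp
next
  assume F: "F \<in> S"
  have "G = F" if G: "G \<in> generated_complex S" "F \<subseteq> G" for G
  proof -
    obtain H where "H \<in> S" "G \<subseteq> H" using G(1) by (auto simp: generated_complex_iff)
    with G(2) show ?thesis
      using uniform_family_subset_eq[OF assms F, of H] by auto
  qed
  with F show "is_facet (generated_complex S) F"
    by (auto simp: is_facet_def generated_complex_iff)
qed

lemma complex_dim_generated_empty: "complex_dim (generated_complex {}) = -1"
  by (simp add: complex_dim_def generated_complex_def)

lemma complex_dim_generated: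
  assumes "uniform_family k S" "S \<noteq> {}"
  shows "complex_dim (generated_complex S) = int k - 1"
proof -
  obtain F where F: "F \<in> S" using assms(2) by blast
  have k: "card G \<le> k" if "G \<in> generated_complex S" for G
    using that assms(1) unfolding generated_complex_iff uniform_family_def by (metis card_mono)
  have "int k - 1 \<in> face_dim ` generated_complex S"
    using F assms(1) unfolding face_dim_def uniform_family_def generated_complex_def
    by (intro image_eqI[of _ _ F]) auto
  with k show ?thesis
    unfolding complex_dim_def
    by (intro Max_eqI) (force simp: face_dim_def finite_generated_complex[OF assms(1)])+
qed

lemma pure_complex_generated:
  assumes "uniform_family k S" "S \<noteq> {}" shows "pure_complex (generated_complex S)"
  using assms(1)
  unfolding pure_complex_def complex_dim_generated[OF assms] is_facet_generated[OF assms(1)]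
  by (simp add: uniform_family_def face_dim_def)

text \<open>Facets are exactly the generators, so deleting above a face filters the family. The
  filtered family is again uniform, which lets deletions be iterated.\<close>

lemma abdel_generated:
  assumes "uniform_family k S"
  shows "abdel F (generated_complex S) = generated_complex {G \<in> S. \<not> F \<subseteq> G}"
  unfolding abdel_def is_facet_generated[OF assms]
  by (simp add: generated_complex_def Bex_def conj_assoc)

lemma facet_above:
  assumes "abstract_complex \<Delta>" "F \<in> \<Delta>"
  obtains G where "is_facet \<Delta> G" "F \<subseteq> G"
proof -
  have "finite \<Delta>" using assms(1) by (simp add: abstract_complex_def)
  from finite_has_maximal2[OF this assms(2)] that show thesis
    unfolding is_facet_def by metis
qed

text \<open>The bridge from an arbitrary pure complex to its family of facets: every face extends to
  a facet, and purity makes all facets equally large.\<close>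

lemma pure_complex_eq_generated:
  assumes "abstract_complex \<Delta>" "pure_complex \<Delta>" "complex_dim \<Delta> \<ge> 0"
  defines "S \<equiv> {F. is_facet \<Delta> F}"
  shows "\<Delta> = generated_complex S" "uniform_family (nat (complex_dim \<Delta> + 1)) S" "S \<noteq> {}"
proof -
  show eq: "\<Delta> = generated_complex S"
  proof (intro set_eqI iffI)
    show "F \<in> generated_complex S" if "F \<in> \<Delta>" for F
      using facet_above[OF assms(1) that] unfolding S_def generated_complex_iff by blast
    show "F \<in> \<Delta>" if "F \<in> generated_complex S" for F
      using that assms(1)
      unfolding S_def generated_complex_iff abstract_complex_def is_facet_def by blast
  qed
  show "uniform_family (nat (complex_dim \<Delta> + 1)) S"
    unfolding uniform_family_def
  proof (intro conjI ballI)
    show "finite S"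
      using assms(1) finite_subset[of S \<Delta>] by (auto simp: S_def abstract_complex_def is_facet_def)
    show "finite F" if "F \<in> S" for F
      using that assms(1) by (simp add: S_def abstract_complex_def is_facet_def)
    show "card F = nat (complex_dim \<Delta> + 1)" if "F \<in> S" for F
      using that assms(2) by (auto simp: S_def pure_complex_def face_dim_def)
  qed
  show "S \<noteq> {}"
    using assms(3) eq complex_dim_generated_empty by (metis neg_0_le_iff_le not_one_le_zero)
qed

section \<open>Stars, simplicial faces and deletion steps\<close>

lemma complex_vertices_star:
  "complex_vertices (face_star F (generated_complex S)) = {v. insert v F \<in> generated_complex S}"
proof -
  have "v \<in> complex_vertices (face_star F (generated_complex S))"
    if "insert v F \<in> generated_complex S" for v
    using that generated_complex_mono[OF that, of "{v}"]
    unfolding complex_vertices_def face_star_def by (auto intro!: bexI[of _ "{v}"])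
  moreover have "insert v F \<in> generated_complex S" if "F \<union> G \<in> generated_complex S" "v \<in> G" for v G
    using that by (auto intro: generated_complex_mono)
  ultimately show ?thesis
    unfolding complex_vertices_def face_star_def by blast
qed

text \<open>The vertices of the star are those \<open>v\<close> for which \<open>insert v F\<close>
  is a face. They are vertices of the complex anyway, so only the condition on small subsets
  remains.\<close>

lemma t_simplicial_generated:
  "t_simplicial t (generated_complex S) F \<longleftrightarrow> F \<in> generated_complex S \<and>
     (\<forall>Y. (\<forall>v\<in>Y. insert v F \<in> generated_complex S) \<and> face_dim Y \<le> t \<longrightarrow> Y \<in> generated_complex S)"
proof -
  have "{v. insert v F \<in> generated_complex S} \<subseteq> \<Union>S"
    unfolding generated_complex_def by blast
  then show ?thesis
    unfolding t_simplicial_def t_clique_def complex_vertices_star complex_vertices_generated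
    by blast
qed

lemma one_simplicial_generatedI:
  assumes "uniform_family k S" "F \<in> generated_complex S"
    and clique: "\<And>u w. insert u F \<in> generated_complex S \<Longrightarrow> insert w F \<in> generated_complex S \<Longrightarrow>
      {u, w} \<in> generated_complex S"
  shows "t_simplicial 1 (generated_complex S) F"
  unfolding t_simplicial_generated
proof (intro conjI allI impI assms(2), elim conjE)
  fix Y assume star: "\<forall>v\<in>Y. insert v F \<in> generated_complex S" and "face_dim Y \<le> 1"
  then have "card Y \<le> 2" by (simp add: face_dim_def)
  \<comment> \<open>The bound on \<open>card Y\<close> says nothing about an infinite
    \<open>Y\<close>, whose cardinality is 0 by convention, so finiteness is derived from the vertex
    set.\<close>
  moreover have "Y \<subseteq> \<Union>S"
    using star unfolding generated_complex_def by blast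
  then have "finite Y"
    using finite_Union_uniform[OF assms(1)] finite_subset by blast
  ultimately consider "Y = {}" | u w where "Y = {u, w}"
    by (metis card_0_eq card_1_singletonE card_2_iff insert_absorb2 le_Suc_eq le_zero_eq
        numeral_2_eq_2 One_nat_def)
  then show "Y \<in> generated_complex S"
  proof cases
    case 1
    then show ?thesis using assms(2) by (auto intro: generated_complex_mono)
  next
    case 2
    then show ?thesis using star clique by simp
  qed
qed

text \<open>All reductions constructed here end in the void complex, whose dimension is -1 by
  convention.\<close>

lemma reducible_byI:
  assumes "(deletion_step t j)\<^sup>*\<^sup>* \<Delta> (generated_complex {})" "0 \<le> j"
  shows "reducible_by t j \<Delta>"
  unfolding reducible_by_def
  using assms by (intro exI[of _ "generated_complex {}"]) (simp add: complex_dim_generated_empty)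

lemma deletion_step_generatedI:
  assumes "uniform_family k S" "face_dim F = j" "t_simplicial t (generated_complex S) F"
  shows "deletion_step t j (generated_complex S) (generated_complex {G \<in> S. \<not> F \<subseteq> G})"
  unfolding deletion_step_def using assms abdel_generated by metis

text \<open>If \<open>G\<close> is the only facet above \<open>F\<close>, the star of
  \<open>F\<close> is the full simplex on \<open>G\<close>. Its vertices form a clique of every
  order, hence the arbitrary \<open>t\<close>.\<close>

lemma deletion_step_free_face:
  assumes "uniform_family k S" "face_dim F = j" "G \<in> S" "F \<subseteq> G" "\<forall>H\<in>S. F \<subseteq> H \<longrightarrow> H = G"
  shows "deletion_step t j (generated_complex S) (generated_complex (S - {G}))"
proof -
  have "v \<in> G" if "insert v F \<in> generated_complex S" for v
    using that assms(5) unfolding generated_complex_def by blast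
  then have "Y \<in> generated_complex S" if "\<forall>v\<in>Y. insert v F \<in> generated_complex S" for Y
    using that assms(3) unfolding generated_complex_iff by (meson subsetI)
  then have "t_simplicial t (generated_complex S) F"
    using assms(3,4) unfolding t_simplicial_generated by (auto simp: generated_complex_iff)
  moreover have "{H \<in> S. \<not> F \<subseteq> H} = S - {G}"
    using assms(3-5) by blast
  ultimately show ?thesis
    using deletion_step_generatedI[OF assms(1,2)] by metis
qed

section \<open>Largest labels\<close>

lemma max_vertex:
  fixes l :: "'a \<Rightarrow> nat"
  assumes "finite V" "V \<noteq> {}"
  obtains n where "n \<in> V" "\<And>v. v \<in> V \<Longrightarrow> l v \<le> l n"
proof -
  have "Max (l ` V) \<in> l ` V" using assms by (intro Max_in) simp_all
  then obtain n where n: "n \<in> V" "Max (l ` V) = l n" by (rule imageE)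
  then have "l v \<le> l n" if "v \<in> V" for v
    using that assms(1) Max_ge[of "l ` V" "l v"] by simp
  with n(1) show thesis by (rule that)
qed

lemma max_label_attained:
  assumes "finite F" "F \<noteq> {}"
  obtains n where "n \<in> F" "max_label l F = l n"
proof -
  have "max_label l F \<in> l ` F"
    unfolding max_label_def using assms by (intro Max_in) simp_all
  then show thesis using that by (rule imageE)
qed

lemma max_label_eq:
  assumes "finite F" "n \<in> F" "\<And>v. v \<in> F \<Longrightarrow> l v \<le> l n"
  shows "max_label l F = l n"
  unfolding max_label_def using assms by (intro Max_eqI) auto

lemma union_minus_max_eq:
  assumes "inj_on l V" "F \<subseteq> V" "G \<subseteq> V" "n \<in> V" "max_label l F = l n"
  shows "union_minus_max l F G = F \<union> G - {n}"
  using assms unfolding union_minus_max_def inj_on_def by auto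

text \<open>If \<open>n\<close> lies in \<open>F\<close> or in \<open>G\<close>, its label is the
  common maximum, so \<open>n\<close> is removed. Hence a face supplied by a chordality condition
  avoids \<open>n\<close> and survives the deletion of facets through \<open>n\<close>.\<close>

lemma max_vertex_notin_union_minus_max:
  assumes "uniform_family k S" "\<And>v. v \<in> \<Union>S \<Longrightarrow> l v \<le> l n"
    and "F \<in> S" "G \<in> S" "max_label l F = max_label l G"
  shows "n \<notin> union_minus_max l F G"
proof
  assume n: "n \<in> union_minus_max l F G"
  have "max_label l H = l n" if "H \<in> S" "n \<in> H" for H
    using that assms(1,2) by (intro max_label_eq) (auto simp: uniform_family_def)
  with n assms(3-5) show False
    unfolding union_minus_max_def by fastforce
qed

section \<open>Reducing a labeled family of facets\<close>

text \<open>Facets have \<open>k\<close> vertices, so ridges have dimension \<open>k - 2\<close>.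
  Distinct facets through a ridge containing the top vertex \<open>n\<close> are adjacent with the
  same maximum; the facet obtained from their union by removing \<open>n\<close> joins their
  remaining vertices, so the ridge is 1-simplicial. The labeling is only assumed injective, because
  subfamilies may lose vertices and bijectivity onto an initial segment with them.\<close>

lemma ridge_reduction:
  fixes l :: "'a \<Rightarrow> nat"
  assumes "uniform_family k S" "2 \<le> k" "inj_on l (\<Union>S)"
    and "\<And>F G. F \<in> S \<Longrightarrow> G \<in> S \<Longrightarrow> F \<noteq> G \<Longrightarrow> adjacent_faces F G \<Longrightarrow>
      max_label l F = max_label l G \<Longrightarrow> union_minus_max l F G \<in> S"
  shows "(deletion_step 1 (int k - 2))\<^sup>*\<^sup>* (generated_complex S) (generated_complex {})"
proof -
  have "finite S" using assms(1) by (simp add: uniform_family_def)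
  then show ?thesis using assms
  proof (induction S rule: finite_psubset_induct)
    case (psubset S)
    note unif = psubset.prems(1) and chordal = psubset.prems(4)
    show ?case
    proof (cases "S = {}")
      case False
      have card: "finite F \<and> card F = k" if "F \<in> S" for F
        using that unif by (simp add: uniform_family_def)
      have "\<Union>S \<noteq> {}"
        using False card \<open>2 \<le> k\<close> by fastforce
      then obtain n where "n \<in> \<Union>S" and top: "\<And>v. v \<in> \<Union>S \<Longrightarrow> l v \<le> l n"
        using max_vertex finite_Union_uniform[OF unif] by metis
      then obtain F where F: "F \<in> S" "n \<in> F" by blast
      have maxn: "max_label l A = l n" if "A \<in> S" "n \<in> A" for A
        using that card top by (intro max_label_eq) auto
      have "F \<noteq> {n}" using card[OF F(1)] \<open>2 \<le> k\<close> by auto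
      then obtain x where x: "x \<in> F" "x \<noteq> n" using F by blast
      \<comment> \<open>The dropped vertex differs from \<open>n\<close>, so every facet above the
        ridge \<open>r\<close> contains \<open>n\<close> and has the label of \<open>n\<close> as
        maximum.\<close>
      define r where "r = F - {x}"
      have r: "n \<in> r" "finite r" "card r = k - 1" "r \<subseteq> F"
        using F x card[OF F(1)] by (auto simp: r_def)
      have "t_simplicial 1 (generated_complex S) r"
      proof (rule one_simplicial_generatedI[OF unif])
        show "r \<in> generated_complex S" using F r(4) by (auto simp: generated_complex_iff)
      next
        fix u w assume "insert u r \<in> generated_complex S" "insert w r \<in> generated_complex S"
        then obtain A B where A: "A \<in> S" "insert u r \<subseteq> A" and B: "B \<in> S" "insert w r \<subseteq> B"
          unfolding generated_complex_def by blast
        show "{u, w} \<in> generated_complex S"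
        \<comment> \<open>If \<open>u\<close> or \<open>w\<close> is \<open>n\<close>, it belongs to
          \<open>r\<close> and hence to both facets, so one of them contains the pair.\<close>
        proof (cases "A = B \<or> u = n \<or> w = n")
          case True
          then show ?thesis using A B r(1) unfolding generated_complex_iff by blast
        next
          case False
          have "A \<inter> B \<subset> A"
            using False uniform_family_subset_eq[OF unif A(1) B(1)] by blast
          then have "card (A \<inter> B) < k"
            using card[OF A(1)] by (metis psubset_card_mono)
          moreover have "k - 1 \<le> card (A \<inter> B)"
            using card_mono[of "A \<inter> B" r] A B card[OF A(1)] r(3) by auto
          ultimately have adj: "adjacent_faces A B"
            using card[OF A(1)] card[OF B(1)] by (simp add: adjacent_faces_def face_dim_def)
          have eqn: "max_label l A = l n" "max_label l B = l n"
            using maxn A B r(1) by auto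
          then have "union_minus_max l A B \<in> S"
            using chordal[OF A(1) B(1) _ adj] False by simp
          moreover have "union_minus_max l A B = A \<union> B - {n}"
            using A(1) B(1) by (intro union_minus_max_eq[OF psubset.prems(3)] eqn \<open>n \<in> \<Union>S\<close>) auto
          ultimately show ?thesis
            using A B False unfolding generated_complex_iff by auto
        qed
      qed
      moreover have "face_dim r = int k - 2"
        using r(3) \<open>2 \<le> k\<close> by (simp add: face_dim_def)
      ultimately have step: "deletion_step 1 (int k - 2) (generated_complex S)
          (generated_complex {G \<in> S. \<not> r \<subseteq> G})"
        using deletion_step_generatedI[OF unif] by metis
      have "(deletion_step 1 (int k - 2))\<^sup>*\<^sup>*
          (generated_complex {G \<in> S. \<not> r \<subseteq> G}) (generated_complex {})"
      proof (rule psubset.IH)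
        show "{G \<in> S. \<not> r \<subseteq> G} \<subset> S" using F r(4) by blast
        show "uniform_family k {G \<in> S. \<not> r \<subseteq> G}"
          using unif by (rule uniform_family_subset) simp
        show "inj_on l (\<Union>{G \<in> S. \<not> r \<subseteq> G})"
          using psubset.prems(3) by (rule inj_on_subset) blast
        \<comment> \<open>The facet supplied by the hypothesis avoids \<open>n\<close>, which lies
          in \<open>r\<close>, so it has not been deleted.\<close>
        show "union_minus_max l A B \<in> {G \<in> S. \<not> r \<subseteq> G}"
          if "A \<in> {G \<in> S. \<not> r \<subseteq> G}" "B \<in> {G \<in> S. \<not> r \<subseteq> G}" "A \<noteq> B" "adjacent_faces A B"
            "max_label l A = max_label l B" for A B
          using that chordal max_vertex_notin_union_minus_max[OF unif, of l n A B] top r(1) by auto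
      qed fact
      with step show ?thesis by (rule converse_rtranclp_into_rtranclp)
    qed simp
  qed
qed

text \<open>Here the top vertex \<open>n\<close> itself is deleted. Two neighbours of
  \<open>n\<close> lie in facets \<open>A\<close> and \<open>B\<close> through \<open>n\<close>;
  they share a facet if \<open>A = B\<close>, and otherwise the hypothesis joins them. The facet
  \<open>H\<close> it provides avoids \<open>n\<close>, so the hypothesis passes to the facets that
  remain.\<close>

lemma vertex_reduction:
  fixes l :: "'a \<Rightarrow> nat"
  assumes "uniform_family k S" "1 \<le> k" "inj_on l (\<Union>S)"
    and "\<And>F G e. F \<in> S \<Longrightarrow> G \<in> S \<Longrightarrow> F \<noteq> G \<Longrightarrow> max_label l F = max_label l G \<Longrightarrow>
      e \<subseteq> union_minus_max l F G \<Longrightarrow> card e = 2 \<Longrightarrow>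
      \<exists>H\<in>S. e \<subseteq> H \<and> H \<subseteq> union_minus_max l F G"
  shows "(deletion_step 1 0)\<^sup>*\<^sup>* (generated_complex S) (generated_complex {})"
proof -
  have "finite S" using assms(1) by (simp add: uniform_family_def)
  then show ?thesis using assms
  proof (induction S rule: finite_psubset_induct)
    case (psubset S)
    note unif = psubset.prems(1) and chordal = psubset.prems(4)
    show ?case
    proof (cases "S = {}")
      case False
      have card: "finite F \<and> card F = k" if "F \<in> S" for F
        using that unif by (simp add: uniform_family_def)
      have "\<Union>S \<noteq> {}"
        using False card \<open>1 \<le> k\<close> by fastforce
      then obtain n where n: "n \<in> \<Union>S" and top: "\<And>v. v \<in> \<Union>S \<Longrightarrow> l v \<le> l n"
        using max_vertex finite_Union_uniform[OF unif] by metis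
      have maxn: "max_label l A = l n" if "A \<in> S" "n \<in> A" for A
        using that card top by (intro max_label_eq) auto
      have "t_simplicial 1 (generated_complex S) {n}"
      proof (rule one_simplicial_generatedI[OF unif])
        show "{n} \<in> generated_complex S" using n by (auto simp: generated_complex_iff)
      next
        fix u w assume "{u, n} \<in> generated_complex S" "{w, n} \<in> generated_complex S"
        then obtain A B where A: "A \<in> S" "u \<in> A" "n \<in> A" and B: "B \<in> S" "w \<in> B" "n \<in> B"
          unfolding generated_complex_def by blast
        show "{u, w} \<in> generated_complex S"
        proof (cases "A = B \<or> u = n \<or> w = n \<or> u = w")
          case True
          then show ?thesis using A B unfolding generated_complex_iff by blast
        next
          case False
          have "union_minus_max l A B = A \<union> B - {n}"
            using union_minus_max_eq[OF psubset.prems(3)] A B maxn n by auto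
          then have "\<exists>H\<in>S. {u, w} \<subseteq> H \<and> H \<subseteq> union_minus_max l A B"
            using False A B maxn by (intro chordal) auto
          then show ?thesis unfolding generated_complex_iff by blast
        qed
      qed
      then have step: "deletion_step 1 0 (generated_complex S)
          (generated_complex {G \<in> S. \<not> {n} \<subseteq> G})"
        by (intro deletion_step_generatedI[OF unif]) (simp_all add: face_dim_def)
      have "(deletion_step 1 0)\<^sup>*\<^sup>*
          (generated_complex {G \<in> S. \<not> {n} \<subseteq> G}) (generated_complex {})"
      proof (rule psubset.IH)
        show "{G \<in> S. \<not> {n} \<subseteq> G} \<subset> S" using n by blast
        show "uniform_family k {G \<in> S. \<not> {n} \<subseteq> G}"
          using unif by (rule uniform_family_subset) simp
        show "inj_on l (\<Union>{G \<in> S. \<not> {n} \<subseteq> G})"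
          using psubset.prems(3) by (rule inj_on_subset) blast
        show "\<exists>H\<in>{G \<in> S. \<not> {n} \<subseteq> G}. e \<subseteq> H \<and> H \<subseteq> union_minus_max l A B"
          if "A \<in> {G \<in> S. \<not> {n} \<subseteq> G}" "B \<in> {G \<in> S. \<not> {n} \<subseteq> G}" "A \<noteq> B"
            "max_label l A = max_label l B" "e \<subseteq> union_minus_max l A B" "card e = 2" for A B e
          using that chordal[of A B e] max_vertex_notin_union_minus_max[OF unif, of l n A B] top by blast
      qed fact
      with step show ?thesis by (rule converse_rtranclp_into_rtranclp)
    qed simp
  qed
qed

section \<open>From chordal labelings to reductions\<close>

definition mid_chordal_labeling :: "'a set set \<Rightarrow> ('a \<Rightarrow> nat) \<Rightarrow> bool" where
  "mid_chordal_labeling \<Delta> l \<longleftrightarrow> vertex_labeling \<Delta> l \<and>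
     (\<forall>F G. is_facet \<Delta> F \<and> is_facet \<Delta> G \<and> F \<noteq> G \<and> card F = card G \<and>
            max_label l F = max_label l G \<longrightarrow>
        (\<forall>e. e \<subseteq> union_minus_max l F G \<and> card e = 2 \<longrightarrow>
           e \<in> \<Delta> \<and>
           (\<exists>H\<in>\<Delta>. card H = card F \<and> e \<subseteq> H \<and> H \<subseteq> union_minus_max l F G)))"

lemma mid_chordal_iff_labeling: "mid_chordal \<Delta> \<longleftrightarrow> (\<exists>l. mid_chordal_labeling \<Delta> l)"
  unfolding mid_chordal_def mid_chordal_labeling_def ..

lemma mid_chordal_labelingD:
  assumes "mid_chordal_labeling \<Delta> l" "is_facet \<Delta> F" "is_facet \<Delta> G" "F \<noteq> G" "card F = card G"
    "max_label l F = max_label l G" "e \<subseteq> union_minus_max l F G" "card e = 2"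
  shows "\<exists>H\<in>\<Delta>. card H = card F \<and> e \<subseteq> H \<and> H \<subseteq> union_minus_max l F G"
  using assms unfolding mid_chordal_labeling_def by simp

lemma inj_on_labeling: "vertex_labeling \<Delta> l \<Longrightarrow> inj_on l (complex_vertices \<Delta>)"
  by (simp add: vertex_labeling_def bij_betw_def)

text \<open>For adjacent facets of size \<open>k\<close> the union has \<open>k + 1\<close>
  vertices, so the face provided by the labeling has \<open>k\<close> of them. By purity it is
  itself a facet, as \<open>ridge_reduction\<close> requires.\<close>

theorem very_weakly_chordal_imp_weakly_ridge_chordal:
  assumes "abstract_complex \<Delta>" "complex_dim \<Delta> \<ge> 1" "pure_complex \<Delta>" "very_weakly_chordal \<Delta>"
  shows "weakly_ridge_chordal \<Delta>"
proof -
  define S where "S = {F. is_facet \<Delta> F}"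
  define k where "k = nat (complex_dim \<Delta> + 1)"
  have "0 \<le> complex_dim \<Delta>" using assms(2) by simp
  note S = pure_complex_eq_generated(1,2)[OF assms(1,3) this, folded S_def k_def]
  have k: "2 \<le> k" "int k - 2 = complex_dim \<Delta> - 1"
    using assms(2) by (auto simp: k_def)
  obtain l where l: "vertex_labeling \<Delta> l" and chordal: "\<And>F G. F \<in> S \<Longrightarrow> G \<in> S \<Longrightarrow> F \<noteq> G \<Longrightarrow>
      adjacent_faces F G \<Longrightarrow> card F = card G \<Longrightarrow> max_label l F = max_label l G \<Longrightarrow>
      union_minus_max l F G \<in> \<Delta>"
    using assms(4) unfolding very_weakly_chordal_def S_def by blast
  have "union_minus_max l F G \<in> S"
    if F: "F \<in> S" and G: "G \<in> S" and FG: "F \<noteq> G" "adjacent_faces F G"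
      "max_label l F = max_label l G" for F G
  proof -
    have fin: "finite F" "finite G" "card F = k" "card G = k"
      using F G S(2) by (auto simp: uniform_family_def)
    have "card (F \<inter> G) = k - 1"
      using FG(2) fin k(1) by (simp add: adjacent_faces_def face_dim_def)
    then have "card (F \<union> G) = k + 1"
      using card_Un_Int[of F G] fin k(1) by simp
    moreover have "F \<noteq> {}" using fin k(1) by auto
    then obtain n where n: "n \<in> F" "max_label l F = l n"
      using max_label_attained[OF fin(1)] by blast
    then have "union_minus_max l F G = F \<union> G - {n}"
      using union_minus_max_eq[OF inj_on_labeling[OF l]] F G
      by (auto simp: complex_vertices_generated S(1))
    ultimately have "card (union_minus_max l F G) = k"
      using n fin by simp
    moreover obtain H where "H \<in> S" "union_minus_max l F G \<subseteq> H"
      using chordal[OF F G FG(1,2) _ FG(3)] fin S(1) by (auto simp: generated_complex_iff)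
    ultimately show ?thesis
      using S(2) by (metis card_subset_eq uniform_family_def)
  qed
  then have "(deletion_step 1 (int k - 2))\<^sup>*\<^sup>* (generated_complex S) (generated_complex {})"
    using inj_on_labeling[OF l] S k(1)
    by (intro ridge_reduction[where l = l]) (auto simp: complex_vertices_generated)
  from reducible_byI[OF this] have "reducible_by 1 (complex_dim \<Delta> - 1) \<Delta>"
    using assms(2) unfolding k(2) S(1)[symmetric] by linarith
  then show ?thesis
    using assms(2) by (simp add: weakly_ridge_chordal_def weakly_face_chordal_def)
qed

text \<open>The faces attached to the pairs \<open>e\<close> have the size of a facet, so purity
  turns them into facets and \<open>vertex_reduction\<close> applies.\<close>

theorem mid_chordal_imp_weakly_vertex_chordal:
  assumes "abstract_complex \<Delta>" "complex_dim \<Delta> \<ge> 1" "pure_complex \<Delta>" "mid_chordal \<Delta>"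
  shows "weakly_vertex_chordal \<Delta>"
proof -
  define S where "S = {F. is_facet \<Delta> F}"
  define k where "k = nat (complex_dim \<Delta> + 1)"
  have "0 \<le> complex_dim \<Delta>" using assms(2) by simp
  note S = pure_complex_eq_generated(1,2)[OF assms(1,3) this, folded S_def k_def]
  obtain l where mid: "mid_chordal_labeling \<Delta> l"
    using assms(4) mid_chordal_iff_labeling by blast
  then have l: "vertex_labeling \<Delta> l" by (simp add: mid_chordal_labeling_def)
  note chordal = mid_chordal_labelingD[OF mid]
  have facet: "H \<in> S" if "H \<in> \<Delta>" "card H = k" for H
    using that S by (metis card_subset_eq generated_complex_iff uniform_family_def)
  have "(deletion_step 1 0)\<^sup>*\<^sup>* (generated_complex S) (generated_complex {})"
  proof (rule vertex_reduction[OF S(2)])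
    show "1 \<le> k" using assms(2) by (simp add: k_def)
    show "inj_on l (\<Union>S)"
      using inj_on_labeling[OF l] S(1) by (simp add: complex_vertices_generated)
    show "\<exists>H\<in>S. e \<subseteq> H \<and> H \<subseteq> union_minus_max l F G"
      if "F \<in> S" "G \<in> S" "F \<noteq> G" "max_label l F = max_label l G"
        "e \<subseteq> union_minus_max l F G" "card e = 2" for F G e
    proof -
      have card: "card F = k" "card G = k"
        using that S(2) by (simp_all add: uniform_family_def)
      then have "\<exists>H\<in>\<Delta>. card H = k \<and> e \<subseteq> H \<and> H \<subseteq> union_minus_max l F G"
        using chordal[of F G e] that by (simp add: S_def)
      then show ?thesis using facet by blast
    qed
  qed
  from reducible_byI[OF this] have "reducible_by 1 0 \<Delta>"
    unfolding S(1)[symmetric] by blast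
  then show ?thesis
    using assms(2) by (simp add: weakly_vertex_chordal_def weakly_face_chordal_def)
qed

text \<open>Adjacent facets leave room for just one \<open>H\<^sub>e\<close>, namely the whole of \<open>(F \<union> G) - {max F}\<close>.\<close>

lemma mid_chordal_imp_very_weakly_chordal:
  assumes "abstract_complex \<Delta>" "mid_chordal \<Delta>"
  shows "very_weakly_chordal \<Delta>"
proof -
  obtain l where mid: "mid_chordal_labeling \<Delta> l"
    using assms(2) mid_chordal_iff_labeling by blast
  then have l: "vertex_labeling \<Delta> l" by (simp add: mid_chordal_labeling_def)
  note chordal = mid_chordal_labelingD[OF mid]
  have "union_minus_max l F G \<in> \<Delta>"
    if F: "is_facet \<Delta> F" and G: "is_facet \<Delta> G" and FG: "F \<noteq> G" "adjacent_faces F G"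
      "card F = card G" "max_label l F = max_label l G" for F G
  proof -
    have fin: "finite F" "finite G" and inV: "F \<subseteq> complex_vertices \<Delta>" "G \<subseteq> complex_vertices \<Delta>"
      using F G assms(1) by (auto simp: is_facet_def abstract_complex_def complex_vertices_def)
    have int: "card (F \<inter> G) + 1 = card F"
      using FG(2) by (simp add: adjacent_faces_def face_dim_def)
    then have "F \<noteq> {}" "G \<noteq> {}" using FG(3) by auto
    obtain n where n: "n \<in> F" "max_label l F = l n"
      using max_label_attained[OF fin(1) \<open>F \<noteq> {}\<close>] .
    obtain m where m: "m \<in> G" "max_label l G = l m"
      using max_label_attained[OF fin(2) \<open>G \<noteq> {}\<close>] .
    \<comment> \<open>The vertices of largest label coincide, so the facets intersect and adjacency
      forces at least two vertices in each. This guarantees a pair \<open>e\<close> to which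
      mid-chordality can be applied.\<close>
    have "m = n"
      using inj_on_labeling[OF l] inV n m FG(4) by (metis inj_onD subsetD)
    then have "0 < card (F \<inter> G)"
      using n(1) m(1) fin by (auto simp: card_gt_0_iff)
    then have two: "2 \<le> card F" using int by simp
    have eq: "union_minus_max l F G = F \<union> G - {n}"
      using union_minus_max_eq[OF inj_on_labeling[OF l] inV] n inV by auto
    have card: "card (union_minus_max l F G) = card F"
      using card_Un_Int[of F G] fin FG(3) int n(1) by (simp add: eq)
    obtain e where "e \<subseteq> union_minus_max l F G" "card e = 2"
      using two card by (metis obtain_subset_with_card_n)
    then obtain H where "H \<in> \<Delta>" "card H = card F" "H \<subseteq> union_minus_max l F G"
      using chordal[OF F G FG(1,3,4)] by blast
    then show ?thesis
      using card fin by (metis card_subset_eq eq finite_Diff finite_Un)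
  qed
  with l show ?thesis unfolding very_weakly_chordal_def by blast
qed

section \<open>An obstruction to very weak chordality, and the Moebius band\<close>

text \<open>Whatever the labeling, some vertex carries the largest label, and all facets through it
  share that maximum. An obstruction at every vertex therefore excludes all labelings at once,
  leaving a finite check.\<close>

lemma not_very_weakly_chordal_generated:
  assumes "uniform_family k S" "\<Union>S \<noteq> {}"
    and obstruction: "\<And>v. v \<in> \<Union>S \<Longrightarrow> \<exists>F\<in>S. \<exists>G\<in>S. v \<in> F \<and> v \<in> G \<and> card (F \<inter> G) + 1 = k \<and>
      F \<union> G - {v} \<notin> generated_complex S"
  shows "\<not> very_weakly_chordal (generated_complex S)"
proof
  assume "very_weakly_chordal (generated_complex S)"
  then obtain l where l: "inj_on l (\<Union>S)" and chordal: "\<And>F G. F \<in> S \<Longrightarrow> G \<in> S \<Longrightarrow> F \<noteq> G \<Longrightarrow>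
      adjacent_faces F G \<Longrightarrow> card F = card G \<Longrightarrow> max_label l F = max_label l G \<Longrightarrow>
      union_minus_max l F G \<in> generated_complex S"
    using inj_on_labeling unfolding very_weakly_chordal_def is_facet_generated[OF assms(1)]
    by (metis complex_vertices_generated)
  obtain n where n: "n \<in> \<Union>S" and top: "\<And>v. v \<in> \<Union>S \<Longrightarrow> l v \<le> l n"
    using max_vertex finite_Union_uniform[OF assms(1)] assms(2) by metis
  obtain F G where F: "F \<in> S" "n \<in> F" and G: "G \<in> S" "n \<in> G" and int: "card (F \<inter> G) + 1 = k"
    and notin: "F \<union> G - {n} \<notin> generated_complex S"
    using obstruction[OF n] by blast
  have card: "finite A \<and> card A = k" if "A \<in> S" for A
    using that assms(1) by (simp add: uniform_family_def)
  have maxn: "max_label l A = l n" if "A \<in> S" "n \<in> A" for A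
    using that card top by (intro max_label_eq) auto
  have "F \<noteq> G"
  proof
    assume "F = G"
    with int card[OF F(1)] show False by simp
  qed
  moreover have "adjacent_faces F G"
    using int card[OF F(1)] card[OF G(1)] by (simp add: adjacent_faces_def face_dim_def)
  ultimately have "union_minus_max l F G \<in> generated_complex S"
    using chordal F G card maxn by simp
  moreover have "union_minus_max l F G = F \<union> G - {n}"
    using union_minus_max_eq[OF l] F G n maxn by auto
  ultimately show False using notin by simp
qed

definition moebius :: "nat set set" where
  "moebius = {{0,1,2}, {1,2,3}, {2,3,4}, {0,3,4}, {0,1,4}}"

lemma uniform_moebius: "uniform_family 3 moebius"
  by (simp add: uniform_family_def moebius_def)

lemma complex_dim_moebius: "complex_dim (generated_complex moebius) = 2"
  using complex_dim_generated[OF uniform_moebius] by (simp add: moebius_def)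

text \<open>Each boundary edge \<open>{i, i+2}\<close> modulo 5 lies in a single facet and stays
  free until that facet is removed. Free edges are simplicial for every \<open>t\<close>, so the
  same chain serves ridge-chordality and its weak form.\<close>

lemma ridge_reduction_moebius:
  "(deletion_step t 1)\<^sup>*\<^sup>* (generated_complex moebius) (generated_complex {})"
proof -
  have step: "deletion_step t 1 (generated_complex S) (generated_complex T)"
    if "S \<subseteq> moebius" "G \<in> S" "T = S - {G}" "card F = 2" "F \<subseteq> G" "\<forall>H\<in>S. F \<subseteq> H \<longrightarrow> H = G" for S T F G
    unfolding that(3)
    by (rule deletion_step_free_face[OF uniform_family_subset[OF uniform_moebius that(1)] _ that(2,5,6)])
      (simp add: face_dim_def that(4))
  note rtranclp.rtrancl_into_rtrancl [trans]
  have "(deletion_step t 1)\<^sup>*\<^sup>* (generated_complex moebius)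
      (generated_complex {{1,2,3}, {2,3,4}, {0,3,4}, {0,1,4}})"
    by (rule r_into_rtranclp, rule step[of _ "{0,1,2}" _ "{0,2}"]) code_simp+
  also have "deletion_step t 1 \<dots> (generated_complex {{2,3,4}, {0,3,4}, {0,1,4}})"
    by (rule step[of _ "{1,2,3}" _ "{1,3}"]) code_simp+
  also have "deletion_step t 1 \<dots> (generated_complex {{0,3,4}, {0,1,4}})"
    by (rule step[of _ "{2,3,4}" _ "{2,4}"]) code_simp+
  also have "deletion_step t 1 \<dots> (generated_complex {{0,1,4}})"
    by (rule step[of _ "{0,3,4}" _ "{0,3}"]) code_simp+
  also have "deletion_step t 1 \<dots> (generated_complex {})"
    by (rule step[of _ "{0,1,4}" _ "{1,4}"]) code_simp+
  finally show ?thesis .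
qed

text \<open>All pairs of vertices are edges, so the vertex 0 is 1-simplicial. Deleting it leaves two
  triangles sharing an edge, which disappear through the free vertices 1 and 2.\<close>

lemma vertex_reduction_moebius:
  "(deletion_step 1 0)\<^sup>*\<^sup>* (generated_complex moebius) (generated_complex {})"
proof -
  have edges: "\<forall>u\<in>\<Union>moebius. \<forall>w\<in>\<Union>moebius. \<exists>G\<in>moebius. {u, w} \<subseteq> G"
    by code_simp
  have "t_simplicial 1 (generated_complex moebius) {0}"
  proof (rule one_simplicial_generatedI[OF uniform_moebius])
    show "{0} \<in> generated_complex moebius"
      unfolding generated_complex_iff by code_simp
    show "{u, w} \<in> generated_complex moebius"
      if "{u, 0} \<in> generated_complex moebius" "{w, 0} \<in> generated_complex moebius" for u w
    proof -
      have "u \<in> \<Union>moebius" "w \<in> \<Union>moebius"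
        using that by (auto simp: generated_complex_iff)
      then show ?thesis unfolding generated_complex_iff by (rule edges[rule_format])
    qed
  qed
  note rtranclp.rtrancl_into_rtrancl [trans]
  from \<open>t_simplicial 1 (generated_complex moebius) {0}\<close>
  have "(deletion_step 1 0)\<^sup>*\<^sup>* (generated_complex moebius)
      (generated_complex {G \<in> moebius. \<not> {0} \<subseteq> G})"
    by (intro r_into_rtranclp deletion_step_generatedI[OF uniform_moebius]) (simp add: face_dim_def)
  also have "{G \<in> moebius. \<not> {0} \<subseteq> G} = {{1,2,3}, {2,3,4}}"
    by (auto simp: moebius_def)
  also have "deletion_step 1 0 (generated_complex \<dots>) (generated_complex ({{1,2,3}, {2,3,4}} - {{1,2,3}}))"
    by (rule deletion_step_free_face[where k = 3 and F = "{1}"])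
      (auto simp: uniform_family_def face_dim_def)
  also have "{{1,2,3}, {2,3,4}} - {{1,2,3}} = {{2,3,4::nat}}"
    by code_simp
  also have "deletion_step 1 0 (generated_complex \<dots>) (generated_complex ({{2,3,4}} - {{2,3,4}}))"
    by (rule deletion_step_free_face[where k = 3 and F = "{2}"])
      (auto simp: uniform_family_def face_dim_def)
  finally show ?thesis by simp
qed

lemma ridge_chordal_moebius: "ridge_chordal (generated_complex moebius)"
  unfolding ridge_chordal_def face_chordal_def complex_dim_moebius
  using reducible_byI[OF ridge_reduction_moebius] by simp

lemma weakly_ridge_chordal_moebius: "weakly_ridge_chordal (generated_complex moebius)"
  unfolding weakly_ridge_chordal_def weakly_face_chordal_def complex_dim_moebius
  using reducible_byI[OF ridge_reduction_moebius] by simp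

lemma weakly_vertex_chordal_moebius: "weakly_vertex_chordal (generated_complex moebius)"
  unfolding weakly_vertex_chordal_def weakly_face_chordal_def complex_dim_moebius
  using reducible_byI[OF vertex_reduction_moebius] by simp

text \<open>At a vertex \<open>v\<close>, the facets \<open>{v-1, v, v+1}\<close> and
  \<open>{v, v+1, v+2}\<close> modulo 5 share an edge, but \<open>{v-1, v+1, v+2}\<close> does not
  consist of consecutive residues and is no face.\<close>

lemma not_very_weakly_chordal_moebius: "\<not> very_weakly_chordal (generated_complex moebius)"
proof (rule not_very_weakly_chordal_generated[OF uniform_moebius])
  show "\<Union>moebius \<noteq> {}" by (simp add: moebius_def)
  have "\<forall>v\<in>\<Union>moebius. \<exists>F\<in>moebius. \<exists>G\<in>moebius. v \<in> F \<and> v \<in> G \<and> card (F \<inter> G) + 1 = 3 \<and>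
      \<not> (\<exists>H\<in>moebius. F \<union> G - {v} \<subseteq> H)"
    by code_simp
  then show "\<exists>F\<in>moebius. \<exists>G\<in>moebius. v \<in> F \<and> v \<in> G \<and> card (F \<inter> G) + 1 = 3 \<and>
      F \<union> G - {v} \<notin> generated_complex moebius" if "v \<in> \<Union>moebius" for v
    using that unfolding generated_complex_iff by blast
qed

lemma not_mid_chordal_moebius: "\<not> mid_chordal (generated_complex moebius)"
  using not_very_weakly_chordal_moebius mid_chordal_imp_very_weakly_chordal
    abstract_complex_generated[OF uniform_moebius] by blast

section \<open>The tetrahedron boundary with two cones over 4-cycles\<close>

text \<open>The base vertices are 1 to 4. The apex 5 is joined to the cycle 1-3-2-4, which misses
  the edges \<open>{1,2}\<close> and \<open>{3,4}\<close>; the apex 6 is joined to 1-2-3-4, which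
  misses \<open>{1,3}\<close> and \<open>{2,4}\<close>.\<close>

definition double_cone :: "nat set set" where
  "double_cone = {{1,2,3}, {1,2,4}, {1,3,4}, {2,3,4},
     {1,3,5}, {2,3,5}, {2,4,5}, {1,4,5}, {1,2,6}, {2,3,6}, {3,4,6}, {1,4,6}}"

lemma uniform_double_cone: "uniform_family 3 double_cone"
  by (simp add: uniform_family_def double_cone_def)

lemma complex_dim_double_cone: "complex_dim (generated_complex double_cone) = 2"
  using complex_dim_generated[OF uniform_double_cone] by (simp add: double_cone_def)

text \<open>The identity labeling works. For distinct facets with maximum 5 or 6, the union without
  the apex consists of at least three base vertices, and all base triples are facets. For maximum 4
  what remains is \<open>{1,2,3}\<close>, and only one facet has maximum 3.\<close>

lemma mid_chordal_double_cone: "mid_chordal (generated_complex double_cone)"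
  unfolding mid_chordal_def is_facet_generated[OF uniform_double_cone]
proof (intro exI[of _ id] conjI allI impI; (elim conjE)?)
  have "\<Union>double_cone = {1..6}" by code_simp
  then show "vertex_labeling (generated_complex double_cone) id"
    by (simp add: vertex_labeling_def complex_vertices_generated)
next
  fix F G e assume F: "F \<in> double_cone" and G: "G \<in> double_cone" and FG: "F \<noteq> G"
    and max: "max_label id F = max_label id G"
    and e: "e \<subseteq> union_minus_max id F G" "card e = 2"
  have eq: "union_minus_max id F G = F \<union> G - {Max F}"
    by (auto simp: union_minus_max_def max_label_def)
  obtain x y where xy: "e = {x, y}" "x \<noteq> y" using e(2) by (auto simp: card_2_iff)
  have in_union: "x \<in> F \<union> G - {Max F}" "y \<in> F \<union> G - {Max F}"
    using e(1) xy(1) unfolding eq by simp_all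
  have "Max F = Max G" using max by (simp add: max_label_def)
  have "\<forall>F\<in>double_cone. \<forall>G\<in>double_cone. F \<noteq> G \<longrightarrow> Max F = Max G \<longrightarrow>
      (\<forall>x\<in>F \<union> G - {Max F}. \<forall>y\<in>F \<union> G - {Max F}. x \<noteq> y \<longrightarrow>
        (\<exists>H\<in>double_cone. x \<in> H \<and> y \<in> H \<and> H \<subseteq> F \<union> G - {Max F}))"
    by code_simp
  from this[rule_format, OF F G FG \<open>Max F = Max G\<close> in_union xy(2)]
  obtain H where H: "H \<in> double_cone" "e \<subseteq> H" "H \<subseteq> union_minus_max id F G"
    unfolding eq xy(1) by auto
  then show "e \<in> generated_complex double_cone" by (auto simp: generated_complex_iff)
  have "card H = card F"
    using F H(1) uniform_double_cone by (simp add: uniform_family_def)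
  with H show "\<exists>H\<in>generated_complex double_cone.
      card H = card F \<and> e \<subseteq> H \<and> H \<subseteq> union_minus_max id F G"
    by (intro bexI[of _ H]) (auto simp: generated_complex_iff)
qed

text \<open>The star of a base edge contains all base vertices and some apex, hence that apex with a
  base edge missed by its cycle. The star of an edge from an apex to \<open>i\<close> contains both
  neighbours of \<open>i\<close> on the cycle, which again span a missed edge. The star of a vertex
  contains those of the edges through it.\<close>

lemma not_simplicial_double_cone:
  assumes "face_dim F = 0 \<or> face_dim F = 1"
  shows "\<not> t_simplicial 2 (generated_complex double_cone) F"
proof
  assume simplicial: "t_simplicial 2 (generated_complex double_cone) F"
  then obtain G where G: "G \<in> double_cone" "F \<subseteq> G"
    unfolding t_simplicial_generated generated_complex_iff by blast
  have "card F = 1 \<or> card F = 2" using assms by (auto simp: face_dim_def)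
  \<comment> \<open>Allowing \<open>x = y\<close> treats vertices and edges in one check.\<close>
  then obtain x y where xy: "F = {x, y}"
    by (metis card_1_singletonE card_2_iff insert_absorb2)
  \<comment> \<open>These are the eight of the twenty vertex triples that are not facets.\<close>
  define N :: "nat set set" where
    "N = {{1,2,5}, {3,4,5}, {1,3,6}, {2,4,6}, {1,5,6}, {2,5,6}, {3,5,6}, {4,5,6}}"
  have "\<forall>G\<in>double_cone. \<forall>x\<in>G. \<forall>y\<in>G. \<exists>Y\<in>N. \<forall>v\<in>Y. \<exists>H\<in>double_cone. {v, x, y} \<subseteq> H"
    unfolding N_def by code_simp
  moreover have "x \<in> G" "y \<in> G" using G(2) xy by simp_all
  ultimately have "\<exists>Y\<in>N. \<forall>v\<in>Y. insert v F \<in> generated_complex double_cone"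
    using G(1) unfolding generated_complex_iff xy by simp
  then obtain Y where Y: "Y \<in> N" "\<forall>v\<in>Y. insert v F \<in> generated_complex double_cone"
    by blast
  have "\<forall>Y\<in>N. \<forall>H\<in>double_cone. card Y = 3 \<and> \<not> Y \<subseteq> H"
    unfolding N_def by code_simp
  with Y(1) have "face_dim Y \<le> 2" "Y \<notin> generated_complex double_cone"
    using G(1) by (auto simp: face_dim_def generated_complex_iff)
  with Y(2) show False
    using simplicial unfolding t_simplicial_generated by blast
qed

text \<open>Not even a first deletion is possible, so a reduction can only be trivial, and the
  complex itself has dimension 2, above \<open>j\<close>.\<close>

lemma not_face_chordal_double_cone:
  assumes "j = 0 \<or> j = 1"
  shows "\<not> face_chordal j (generated_complex double_cone)"
proof
  assume "face_chordal j (generated_complex double_cone)"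
  then obtain \<Gamma> where "(deletion_step 2 j)\<^sup>*\<^sup>* (generated_complex double_cone) \<Gamma>"
    and dim: "complex_dim \<Gamma> \<le> j"
    unfolding face_chordal_def reducible_by_def complex_dim_double_cone by blast
  then show False
  proof (cases rule: converse_rtranclpE)
    case base
    then show False using dim assms complex_dim_double_cone by auto
  next
    case step
    then show False
      using assms not_simplicial_double_cone unfolding deletion_step_def by metis
  qed
qed

section \<open>Combining the two implications with the two examples\<close>

theorem theorem91:
  "(\<forall>\<Delta> :: 'a set set.
      abstract_complex \<Delta> \<and> complex_dim \<Delta> \<ge> 1 \<and> pure_complex \<Delta> \<and> very_weakly_chordal \<Delta>
        \<longrightarrow> weakly_ridge_chordal \<Delta>) \<and>
   (\<forall>\<Delta> :: 'a set set.
      abstract_complex \<Delta> \<and> complex_dim \<Delta> \<ge> 1 \<and> pure_complex \<Delta> \<and> mid_chordal \<Delta>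
        \<longrightarrow> weakly_vertex_chordal \<Delta>) \<and>
   (\<exists>\<Delta> :: nat set set.
      abstract_complex \<Delta> \<and> complex_dim \<Delta> \<ge> 1 \<and> pure_complex \<Delta> \<and>
      mid_chordal \<Delta> \<and> \<not> ridge_chordal \<Delta>) \<and>
   (\<exists>\<Delta> :: nat set set.
      abstract_complex \<Delta> \<and> complex_dim \<Delta> \<ge> 1 \<and> pure_complex \<Delta> \<and>
      ridge_chordal \<Delta> \<and> \<not> mid_chordal \<Delta>) \<and>
   (\<exists>\<Delta> :: nat set set.
      abstract_complex \<Delta> \<and> complex_dim \<Delta> \<ge> 1 \<and> pure_complex \<Delta> \<and>
      mid_chordal \<Delta> \<and> \<not> vertex_chordal \<Delta>) \<and>
   (\<exists>\<Delta> :: nat set set.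
      abstract_complex \<Delta> \<and> complex_dim \<Delta> \<ge> 1 \<and> pure_complex \<Delta> \<and>
      weakly_ridge_chordal \<Delta> \<and> \<not> very_weakly_chordal \<Delta>) \<and>
   (\<exists>\<Delta> :: nat set set.
      abstract_complex \<Delta> \<and> complex_dim \<Delta> \<ge> 1 \<and> pure_complex \<Delta> \<and>
      weakly_vertex_chordal \<Delta> \<and> \<not> mid_chordal \<Delta>)"
proof -
  have moebius: "abstract_complex (generated_complex moebius) \<and>
      complex_dim (generated_complex moebius) \<ge> 1 \<and> pure_complex (generated_complex moebius)"
  proof (intro conjI)
    show "abstract_complex (generated_complex moebius)"
      using uniform_moebius by (rule abstract_complex_generated)
    show "pure_complex (generated_complex moebius)"
      using uniform_moebius by (rule pure_complex_generated) (simp add: moebius_def)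
  qed (simp add: complex_dim_moebius)
  have cone: "abstract_complex (generated_complex double_cone) \<and>
      complex_dim (generated_complex double_cone) \<ge> 1 \<and>
      pure_complex (generated_complex double_cone) \<and> mid_chordal (generated_complex double_cone)"
  proof (intro conjI mid_chordal_double_cone)
    show "abstract_complex (generated_complex double_cone)"
      using uniform_double_cone by (rule abstract_complex_generated)
    show "pure_complex (generated_complex double_cone)"
      using uniform_double_cone by (rule pure_complex_generated) (simp add: double_cone_def)
  qed (simp add: complex_dim_double_cone)
  \<comment> \<open>In dimension 2 ridges are edges, so ridge-chordality is the case
    \<open>j = 1\<close> and vertex-chordality the case \<open>j = 0\<close>.\<close>
  have not_ridge: "\<not> ridge_chordal (generated_complex double_cone)"
    and not_vertex: "\<not> vertex_chordal (generated_complex double_cone)"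
    by (simp_all add: ridge_chordal_def vertex_chordal_def complex_dim_double_cone
        not_face_chordal_double_cone)
  show ?thesis
  proof (intro conjI)
    show "\<forall>\<Delta> :: 'a set set. abstract_complex \<Delta> \<and> complex_dim \<Delta> \<ge> 1 \<and> pure_complex \<Delta> \<and>
        very_weakly_chordal \<Delta> \<longrightarrow> weakly_ridge_chordal \<Delta>"
      by (simp add: very_weakly_chordal_imp_weakly_ridge_chordal)
    show "\<forall>\<Delta> :: 'a set set. abstract_complex \<Delta> \<and> complex_dim \<Delta> \<ge> 1 \<and> pure_complex \<Delta> \<and>
        mid_chordal \<Delta> \<longrightarrow> weakly_vertex_chordal \<Delta>"
      by (simp add: mid_chordal_imp_weakly_vertex_chordal)
  qed (use cone not_ridge not_vertex in blast,
       use moebius ridge_chordal_moebius not_mid_chordal_moebius in blast,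
       use cone not_ridge not_vertex in blast,
       use moebius weakly_ridge_chordal_moebius not_very_weakly_chordal_moebius in blast,
       use moebius weakly_vertex_chordal_moebius not_mid_chordal_moebius in blast)
qed

end
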